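(* Let $\Omega$ be a set with a flow $(\theta_t)_{t\in\mathbb R}$, let $K>0$, let $(\mu_\omega)_{\omega\in\Omega}$ be a family in $\mathfrak m$ such that $(\mu_{\theta_t\omega})_{t\in[0,T]}\in\mathfrak m_T$ for all $\omega\in\Omega$ and $T>0$. Then, for every $\omega\in\Omega$, the solution operator $$U^C_\omega(1):C([-1,0])\to C([-1,0]),\qquad (U^C_\omega(1)u_0)(s)=z(1+s),\quad s\in[-1,0],$$ is compact, where $z$ is the solution with initial history $u_0$ and coefficient path $(\mu_{\theta_t\omega})_{t}$.
   Context: $\mathfrak m$ is the set of finite signed Borel measures on $[-1,0]$ with total variation norm at most $K$. $\mathfrak m_T$ is the set of all maps $\mu:[0,T]\to\mathfrak m$, $t\mapsto\mu_t$, such that for every $f\in C([-1,0])$ the function $t\mapsto\int_{[-1,0]}f\,d\mu_t$ is Lebesgue measurable on $[0,T]$. A flow means $\theta_0=\mathrm{id}$ and $\theta_{t+s}=\theta_t\circ\theta_s$. The solution $z$ is the unique continuous function with $z=u_0$ on $[-1,0]$ and $z(t)=u_0(0)+\int_0^t\int_{[-1,0]}z(\tau+s)\,d\mu_{\theta_\tau\omega}(s)\,d\tau$ for $t\ge0$. $C([-1,0])$ carries the supremum norm. *)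

theory Defs
  imports "HOL-Analysis.Analysis"
begin

text \<open>
  A finite signed measure on a measurable space is a countably additive real-valued set function;
  only its values on \<open>sets M\<close> matter.
\<close>
definition signed_measure :: "'a measure \<Rightarrow> ('a set \<Rightarrow> real) \<Rightarrow> bool" where
  "signed_measure M \<nu> \<longleftrightarrow>
     \<nu> {} = 0 \<and>
     (\<forall>A :: nat \<Rightarrow> 'a set. range A \<subseteq> sets M \<longrightarrow> disjoint_family A \<longrightarrow>
        (\<lambda>n. \<nu> (A n)) sums \<nu> (\<Union>n. A n))"

definition total_variation :: "'a measure \<Rightarrow> ('a set \<Rightarrow> real) \<Rightarrow> ennreal" where
  "total_variation M \<nu> =
     (SUP P \<in> {P. finite P \<and> P \<subseteq> sets M \<and> partition_on (space M) P}. \<Sum>A\<in>P. ennreal \<bar>\<nu> A\<bar>)"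

text \<open>
  The positive part of the Jordan decomposition.  Since \<open>ennreal\<close> sends negative reals to \<open>0\<close>
  and \<open>{}\<close> is among the sets \<open>B\<close>, the supremum is the usual one; the negative part is the
  positive part of the negated set function.
\<close>
definition jordan_pos :: "'a measure \<Rightarrow> ('a set \<Rightarrow> real) \<Rightarrow> 'a measure" where
  "jordan_pos M \<nu> =
     measure_of (space M) (sets M) (\<lambda>A. SUP B \<in> {B \<in> sets M. B \<subseteq> A}. ennreal (\<nu> B))"

definition jordan_neg :: "'a measure \<Rightarrow> ('a set \<Rightarrow> real) \<Rightarrow> 'a measure" where
  "jordan_neg M \<nu> = jordan_pos M (\<lambda>A. - \<nu> A)"

definition signed_integral :: "'a measure \<Rightarrow> ('a set \<Rightarrow> real) \<Rightarrow> ('a \<Rightarrow> real) \<Rightarrow> real" where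
  "signed_integral M \<nu> f = integral\<^sup>L (jordan_pos M \<nu>) f - integral\<^sup>L (jordan_neg M \<nu>) f"

abbreviation history_borel :: "real measure" where
  "history_borel \<equiv> restrict_space borel {-1..0}"

definition signed_measures_le :: "real \<Rightarrow> (real set \<Rightarrow> real) set" where
  "signed_measures_le K =
     {\<nu>. signed_measure history_borel \<nu> \<and> total_variation history_borel \<nu> \<le> ennreal K}"

text \<open>Paths are functions on all of \<open>\<real>\<close>, of which only the restriction to \<open>[0,T]\<close> is constrained.\<close>
definition measurable_paths :: "real \<Rightarrow> real \<Rightarrow> (real \<Rightarrow> real set \<Rightarrow> real) set" where
  "measurable_paths K T =
     {\<nu>. (\<forall>t\<in>{0..T}. \<nu> t \<in> signed_measures_le K) \<and>
         (\<forall>f. continuous_on {-1..0} f \<longrightarrow>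
            (\<lambda>t. signed_integral history_borel (\<nu> t) f) \<in> borel_measurable (lebesgue_on {0..T}))}"

definition flow_on :: "'w set \<Rightarrow> (real \<Rightarrow> 'w \<Rightarrow> 'w) \<Rightarrow> bool" where
  "flow_on \<Omega> \<theta> \<longleftrightarrow>
     (\<forall>t. \<theta> t \<in> \<Omega> \<rightarrow> \<Omega>) \<and>
     (\<forall>\<omega>\<in>\<Omega>. \<theta> 0 \<omega> = \<omega>) \<and>
     (\<forall>s t. \<forall>\<omega>\<in>\<Omega>. \<theta> (t + s) \<omega> = \<theta> t (\<theta> s \<omega>))"

text \<open>
  \<open>C([-1,0])\<close> with the supremum metric.  Its elements are \<open>undefined\<close> outside \<open>[-1,0]\<close>, so that
  they are determined by their values on \<open>[-1,0]\<close>.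
\<close>
definition C_hist :: "(real \<Rightarrow> real) metric" where
  "C_hist = cfunspace (top_of_set {-1..0}) euclidean_metric"

definition is_solution ::
    "(real \<Rightarrow> real set \<Rightarrow> real) \<Rightarrow> (real \<Rightarrow> real) \<Rightarrow> (real \<Rightarrow> real) \<Rightarrow> bool" where
  "is_solution \<nu> u0 z \<longleftrightarrow>
     continuous_on {-1..} z \<and>
     (\<forall>s\<in>{-1..0}. z s = u0 s) \<and>
     (\<forall>t\<ge>0.
        integrable (lebesgue_on {0..t})
          (\<lambda>\<tau>. signed_integral history_borel (\<nu> \<tau>) (\<lambda>s. z (\<tau> + s))) \<and>
        z t = u0 0 + (LINT \<tau>|lebesgue_on {0..t}.
          signed_integral history_borel (\<nu> \<tau>) (\<lambda>s. z (\<tau> + s))))"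

text \<open>The solution is a function on \<open>[-1,\<infinity>)\<close>; extensionality makes it unique as a HOL function.\<close>
definition solution ::
    "(real \<Rightarrow> real set \<Rightarrow> real) \<Rightarrow> (real \<Rightarrow> real) \<Rightarrow> real \<Rightarrow> real" where
  "solution \<nu> u0 = (THE z. z \<in> extensional {-1..} \<and> is_solution \<nu> u0 z)"

definition solution_operator ::
    "(real \<Rightarrow> real set \<Rightarrow> real) \<Rightarrow> real \<Rightarrow> (real \<Rightarrow> real) \<Rightarrow> real \<Rightarrow> real" where
  "solution_operator \<nu> t u0 = (\<lambda>s\<in>{-1..0}. solution \<nu> u0 (t + s))"

text \<open>
  A compact operator on \<open>C([-1,0])\<close>: a linear self-map taking bounded sets to relatively compact
  sets.  Linear combinations are restricted to \<open>[-1,0]\<close> to stay in the carrier of \<open>C_hist\<close>.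
\<close>
definition compact_operator_C :: "((real \<Rightarrow> real) \<Rightarrow> real \<Rightarrow> real) \<Rightarrow> bool" where
  "compact_operator_C U \<longleftrightarrow>
     U \<in> mspace C_hist \<rightarrow> mspace C_hist \<and>
     (\<forall>a b. \<forall>u\<in>mspace C_hist. \<forall>v\<in>mspace C_hist.
        U (\<lambda>s\<in>{-1..0}. a * u s + b * v s) = (\<lambda>s\<in>{-1..0}. a * U u s + b * U v s)) \<and>
     (\<forall>B. Metric_space.mbounded (mspace C_hist) (mdist C_hist) B \<longrightarrow>
        compactin (mtopology_of C_hist) (mtopology_of C_hist closure_of (U ` B)))"

end

theory Submission
  imports Defs "HOL-Complex_Analysis.Great_Picard"
begin

text \<open>
  The operator is compact because it gains one derivative: over \<open>[0,1]\<close> the solution is an integral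
  of a bounded function, so a bounded set of histories is sent to a bounded and equi-Lipschitz set,
  and the theorem of Arzela and Ascoli applies. The time \<open>1\<close> is the length of the
  delay: from then on the whole window, here \<open>[0,1]\<close>, lies where the equation has already smoothed the initial history.

  The quantitative input is that integration against a coefficient \<open>\<nu>\<close> is a linear functional
  on \<open>C([-1,0])\<close> of norm at most \<open>2 * K\<close>. This follows once the Jordan part is known to be a
  measure (\<open>emeasure_jordan_pos\<close>), since each of the two parts has mass at most \<open>K\<close>; the factor \<open>2\<close>
  is not optimal, but the size of the constant is irrelevant to compactness. Write
  \<open>drift z \<tau>\<close> for the right-hand side of the equation. The path of coefficients is measurable only
  against a fixed continuous function, whereas \<open>drift z\<close> tests it against a history that moves with
  time; \<open>borel_measurable_drift\<close> closes this gap by freezing the history on a fine grid of times.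

  Solutions are then controlled by exponentially weighted norms. With a weight \<open>exp (L * t)\<close> the
  integral of the drift is small by the factor \<open>2 * K / L\<close> (\<open>abs_integral_drift_le\<close>). For
  \<open>L = 4 * K\<close> this gives an a priori bound on every solution (\<open>solution_growth\<close>), hence uniqueness
  by linearity, and for \<open>L = 8 * K\<close> it makes the integral equation a contraction on all of
  \<open>[0,\<infinity>)\<close> at once (\<open>is_solution_exists\<close>). So the definite description in \<open>solution\<close> denotes the
  solution; linearity of the operator is uniqueness once more, and the a priori bound yields the
  Lipschitz constant (\<open>solution_lipschitz\<close>) that the compactness criterion needs.
\<close>

section \<open>Integration against signed measures\<close>

lemma signed_measure_Un:
  assumes \<nu>: "signed_measure M \<nu>" and "A \<in> sets M" "B \<in> sets M" "A \<inter> B = {}"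
  shows "\<nu> (A \<union> B) = \<nu> A + \<nu> B"
proof -
  have "disjoint_family (binaryset A B)"
    using assms by (auto simp: disjoint_family_on_def binaryset_def)
  moreover have "range (binaryset A B) \<subseteq> sets M"
    using assms by (auto simp: range_binaryset_eq)
  ultimately have "(\<lambda>n. \<nu> (binaryset A B n)) sums \<nu> (A \<union> B)"
    using \<nu> UN_binaryset_eq[of A B] unfolding signed_measure_def by metis
  moreover have "(\<lambda>n. \<nu> (binaryset A B n)) sums (\<nu> A + \<nu> B)"
    using \<nu> by (intro binaryset_sums) (simp add: signed_measure_def)
  ultimately show ?thesis by (rule sums_unique2)
qed

lemma signed_measure_uminus:
  assumes "signed_measure M \<nu>" shows "signed_measure M (\<lambda>A. - \<nu> A)"
  using assms unfolding signed_measure_def by (auto intro!: sums_minus)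

lemma total_variation_uminus [simp]: "total_variation M (\<lambda>A. - \<nu> A) = total_variation M \<nu>"
  by (simp add: total_variation_def)

text \<open>
  A set and its complement form a partition of the space, except when one of them is empty; the
  empty block is discarded because a partition has none.
\<close>
lemma abs_le_total_variation:
  assumes "\<nu> {} = 0" and A: "A \<in> sets M"
  shows "ennreal \<bar>\<nu> A\<bar> \<le> total_variation M \<nu>"
proof (cases "A = {}")
  case False
  define P where "P = {A, space M - A} - {{}}"
  have P: "finite P" "P \<subseteq> sets M" "partition_on (space M) P"
    using A sets.sets_into_space[OF A] by (auto simp: P_def partition_on_def disjoint_def)
  have "ennreal \<bar>\<nu> A\<bar> \<le> (\<Sum>B\<in>P. ennreal \<bar>\<nu> B\<bar>)"
    using False by (intro member_le_sum) (auto simp: P_def)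
  also have "\<dots> \<le> total_variation M \<nu>"
    unfolding total_variation_def using P by (intro SUP_upper) auto
  finally show ?thesis .
qed (use assms in simp)

lemma space_jordan_pos [simp]: "space (jordan_pos M \<nu>) = space M"
  and sets_jordan_pos [simp]: "sets (jordan_pos M \<nu>) = sets M"
  by (simp_all add: jordan_pos_def sets.space_closed)

lemma measurable_jordan_pos [simp]: "measurable (jordan_pos M \<nu>) N = measurable M N"
  by (rule measurable_cong_sets) simp_all

text \<open>
  Subsets of \<open>A\<close> and of \<open>B\<close> are united to a subset of \<open>A \<union> B\<close>. A subset of negative value is
  dropped rather than united, because \<open>ennreal\<close> has already replaced its value by \<open>0\<close>.
\<close>
lemma sup_subsets_superadditive:
  fixes \<nu> :: "'a set \<Rightarrow> real"
  assumes \<nu>: "signed_measure M \<nu>" and A: "A \<in> sets M" and B: "B \<in> sets M" and AB: "A \<inter> B = {}"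
  shows "(SUP C \<in> {C \<in> sets M. C \<subseteq> A}. ennreal (\<nu> C)) + (SUP C \<in> {C \<in> sets M. C \<subseteq> B}. ennreal (\<nu> C))
    \<le> (SUP C \<in> {C \<in> sets M. C \<subseteq> A \<union> B}. ennreal (\<nu> C))" (is "?P A + ?P B \<le> ?P (A \<union> B)")
proof -
  have *: "ennreal (\<nu> C) + ennreal (\<nu> D) \<le> ?P (A \<union> B)"
    if CD: "C \<in> sets M" "C \<subseteq> A" "D \<in> sets M" "D \<subseteq> B" for C D
  proof -
    consider "\<nu> C \<le> 0" | "\<nu> D \<le> 0" | "\<nu> C \<ge> 0" "\<nu> D \<ge> 0" by linarith
    then show ?thesis
    proof cases
      case 1
      then have "ennreal (\<nu> C) + ennreal (\<nu> D) = ennreal (\<nu> D)" by (simp add: ennreal_neg)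
      then show ?thesis using CD by (auto intro!: SUP_upper)
    next
      case 2
      then have "ennreal (\<nu> C) + ennreal (\<nu> D) = ennreal (\<nu> C)" by (simp add: ennreal_neg)
      then show ?thesis using CD by (auto intro!: SUP_upper)
    next
      case 3
      have "\<nu> (C \<union> D) = \<nu> C + \<nu> D"
        using CD AB by (intro signed_measure_Un[OF \<nu>]) auto
      then have "ennreal (\<nu> C) + ennreal (\<nu> D) = ennreal (\<nu> (C \<union> D))"
        using 3 by (simp add: ennreal_plus)
      then show ?thesis using CD by (auto intro!: SUP_upper)
    qed
  qed
  have ne: "{C \<in> sets M. C \<subseteq> X} \<noteq> {}" for X by auto
  have "?P A + ?P B = (SUP C \<in> {C \<in> sets M. C \<subseteq> A}. ennreal (\<nu> C) + ?P B)"
    by (rule ennreal_SUP_add_left[OF ne, symmetric])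
  also have "\<dots> = (SUP C \<in> {C \<in> sets M. C \<subseteq> A}. SUP D \<in> {C \<in> sets M. C \<subseteq> B}. ennreal (\<nu> C) + ennreal (\<nu> D))"
    by (intro SUP_cong refl ennreal_SUP_add_right ne)
  also have "\<dots> \<le> ?P (A \<union> B)"
    by (intro SUP_least) (use * in auto)
  finally show ?thesis .
qed

text \<open>
  The definition by \<open>measure_of\<close> only has the intended value if the set function is countably
  additive. One inequality is finite superadditivity passed to the limit. For the other, any
  measurable subset \<open>B\<close> of the union is cut into the pieces \<open>B \<inter> A i\<close>, whose values are at most the
  suprema over the subsets of \<open>A i\<close>; countable additivity of \<open>\<nu>\<close> reassembles them.
\<close>
lemma emeasure_jordan_pos:
  fixes \<nu> :: "'a set \<Rightarrow> real"
  assumes \<nu>: "signed_measure M \<nu>" and "A \<in> sets M"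
  shows "emeasure (jordan_pos M \<nu>) A = (SUP B \<in> {B \<in> sets M. B \<subseteq> A}. ennreal (\<nu> B))"
proof (rule emeasure_measure_of[OF jordan_pos_def])
  define P where "P A = (SUP B \<in> {B \<in> sets M. B \<subseteq> A}. ennreal (\<nu> B))" for A
  have \<nu>0: "\<nu> {} = 0" using \<nu> by (simp add: signed_measure_def)
  have P0: "P {} = 0"
  proof -
    have "{B \<in> sets M. B \<subseteq> {}} = {{}}" by auto
    then show ?thesis by (simp add: P_def \<nu>0)
  qed
  then show "positive (sets (jordan_pos M \<nu>)) (\<lambda>A. SUP B \<in> {B \<in> sets M. B \<subseteq> A}. ennreal (\<nu> B))"
    by (simp add: positive_def P_def)
  have P_mono: "P A \<le> P B" if "A \<subseteq> B" for A B
    unfolding P_def using that by (intro SUP_subset_mono) auto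
  have P_Un: "P A + P B \<le> P (A \<union> B)" if "A \<in> sets M" "B \<in> sets M" "A \<inter> B = {}" for A B
    unfolding P_def by (rule sup_subsets_superadditive[OF \<nu> that])
  show "countably_additive (sets (jordan_pos M \<nu>)) (\<lambda>A. SUP B \<in> {B \<in> sets M. B \<subseteq> A}. ennreal (\<nu> B))"
    unfolding countably_additive_def P_def[symmetric] sets_jordan_pos
  proof (intro allI impI antisym)
    fix A :: "nat \<Rightarrow> 'a set"
    assume A: "range A \<subseteq> sets M" "disjoint_family A" "\<Union> (range A) \<in> sets M"
    show "(\<Sum>i. P (A i)) \<le> P (\<Union> (range A))"
    proof (rule suminf_le_const[OF summableI])
      fix n
      have "(\<Sum>i<n. P (A i)) \<le> P (\<Union>i<n. A i)"
      proof (induction n)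
        case (Suc n)
        have "(\<Union>i<n. A i) \<inter> A n = {}"
          using A(2) by (auto simp: disjoint_family_on_def) (metis IntI empty_iff nless_le)
        then have "P (\<Union>i<n. A i) + P (A n) \<le> P ((\<Union>i<n. A i) \<union> A n)"
          using A(1) by (intro P_Un) auto
        moreover have "(\<Sum>i<Suc n. P (A i)) \<le> P (\<Union>i<n. A i) + P (A n)"
          using Suc by (auto intro: add_right_mono)
        moreover have "(\<Union>i<n. A i) \<union> A n = (\<Union>i<Suc n. A i)"
          by (auto simp: less_Suc_eq)
        ultimately show ?case by (metis order_trans)
      qed (simp add: P0)
      also have "\<dots> \<le> P (\<Union> (range A))" by (rule P_mono) auto
      finally show "(\<Sum>i<n. P (A i)) \<le> P (\<Union> (range A))" .
    qed
    \<comment> \<open>The values of the pieces may have both signs, so the comparison is made on partial sums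
      of positive parts, before the limit is taken.\<close>
    have "ennreal (\<nu> B) \<le> (\<Sum>i. P (A i))" if B: "B \<in> sets M" "B \<subseteq> \<Union> (range A)" for B
    proof -
      have "(\<lambda>n. \<nu> (B \<inter> A n)) sums \<nu> (\<Union>n. B \<inter> A n)"
        using \<nu> A B unfolding signed_measure_def disjoint_family_on_def
        by (auto dest!: spec[where x="\<lambda>n. B \<inter> A n"])
      moreover have "(\<Union>n. B \<inter> A n) = B" using B by auto
      ultimately have "(\<lambda>n. \<nu> (B \<inter> A n)) sums \<nu> B" by simp
      then have "(\<lambda>n. ennreal (\<Sum>i<n. \<nu> (B \<inter> A i))) \<longlonglongrightarrow> ennreal (\<nu> B)"
        unfolding sums_def by (rule tendsto_ennrealI)
      moreover have "ennreal (\<Sum>i<n. \<nu> (B \<inter> A i)) \<le> (\<Sum>i. P (A i))" for n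
      proof -
        have "ennreal (\<Sum>i<n. \<nu> (B \<inter> A i)) \<le> ennreal (\<Sum>i<n. max 0 (\<nu> (B \<inter> A i)))"
          by (intro ennreal_leI sum_mono) simp
        also have "\<dots> = (\<Sum>i<n. ennreal (max 0 (\<nu> (B \<inter> A i))))"
          by (rule sum_ennreal[symmetric]) simp
        also have "\<dots> = (\<Sum>i<n. ennreal (\<nu> (B \<inter> A i)))"
          by (simp add: ennreal_max_0)
        also have "\<dots> \<le> (\<Sum>i<n. P (A i))"
          unfolding P_def using A B by (intro sum_mono SUP_upper) auto
        also have "\<dots> \<le> (\<Sum>i. P (A i))"
          by (rule sum_le_suminf[OF summableI]) auto
        finally show ?thesis .
      qed
      ultimately show ?thesis by (meson LIMSEQ_le_const2)
    qed
    then show "P (\<Union> (range A)) \<le> (\<Sum>i. P (A i))"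
      unfolding P_def by (intro SUP_least) auto
  qed
qed (use assms sets.space_closed in auto)

text \<open>
  With this crude bound for each part the integral functional below has norm at most \<open>2 * K\<close>; the
  sharp \<open>K\<close> would require a joint estimate of the two parts.
\<close>
lemma emeasure_jordan_pos_le:
  assumes \<nu>: "signed_measure M \<nu>" and TV: "total_variation M \<nu> \<le> ennreal K"
  shows "emeasure (jordan_pos M \<nu>) (space M) \<le> ennreal K"
proof -
  have "ennreal (\<nu> B) \<le> ennreal K" if "B \<in> sets M" for B
  proof -
    have "ennreal (\<nu> B) \<le> ennreal \<bar>\<nu> B\<bar>" by (rule ennreal_leI) simp
    also have "\<dots> \<le> total_variation M \<nu>"
      using \<nu> that by (intro abs_le_total_variation) (simp_all add: signed_measure_def)
    finally show ?thesis using TV by simp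
  qed
  then show ?thesis using \<nu> by (auto simp: emeasure_jordan_pos intro!: SUP_least)
qed

lemma finite_measure_jordan_pos:
  assumes "signed_measure M \<nu>" "total_variation M \<nu> \<le> ennreal K"
  shows "finite_measure (jordan_pos M \<nu>)"
  using emeasure_jordan_pos_le[OF assms] by (intro finite_measureI) (auto simp: top_unique)

lemma integrable_jordan_pos:
  fixes f :: "'a \<Rightarrow> real"
  assumes "signed_measure M \<nu>" "total_variation M \<nu> \<le> ennreal K"
    and "f \<in> borel_measurable M" and "\<And>x. x \<in> space M \<Longrightarrow> \<bar>f x\<bar> \<le> C"
  shows "integrable (jordan_pos M \<nu>) f"
proof -
  interpret finite_measure "jordan_pos M \<nu>" by (rule finite_measure_jordan_pos) fact+
  show ?thesis
    using assms by (intro integrable_const_bound[where B=C]) auto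
qed

lemma abs_integral_jordan_pos_le:
  fixes f :: "'a \<Rightarrow> real"
  assumes \<nu>: "signed_measure M \<nu>" "total_variation M \<nu> \<le> ennreal K" and "K \<ge> 0"
    and f: "f \<in> borel_measurable M" "\<And>x. x \<in> space M \<Longrightarrow> \<bar>f x\<bar> \<le> C" and "C \<ge> 0"
  shows "\<bar>integral\<^sup>L (jordan_pos M \<nu>) f\<bar> \<le> K * C"
proof -
  interpret finite_measure "jordan_pos M \<nu>" by (rule finite_measure_jordan_pos) fact+
  have "\<bar>integral\<^sup>L (jordan_pos M \<nu>) f\<bar> \<le> integral\<^sup>L (jordan_pos M \<nu>) (\<lambda>_. C)"
    using f integrable_jordan_pos[OF \<nu> f] by (intro integral_abs_bound[THEN order_trans] integral_mono) auto
  also have "\<dots> = measure (jordan_pos M \<nu>) (space M) * C" by simp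
  also have "\<dots> \<le> K * C"
    using emeasure_jordan_pos_le[OF \<nu>] \<open>K \<ge> 0\<close> \<open>C \<ge> 0\<close>
    by (intro mult_right_mono) (simp_all add: emeasure_eq_measure)
  finally show ?thesis .
qed

lemma signed_integral_cong:
  assumes "\<And>x. x \<in> space M \<Longrightarrow> f x = g x"
  shows "signed_integral M \<nu> f = signed_integral M \<nu> g"
  unfolding signed_integral_def jordan_neg_def
  using assms by (auto intro!: arg_cong2[where f="(-)"] Bochner_Integration.integral_cong)

lemma abs_signed_integral_le:
  assumes \<nu>: "signed_measure M \<nu>" "total_variation M \<nu> \<le> ennreal K" and "K \<ge> 0"
    and f: "f \<in> borel_measurable M" "\<And>x. x \<in> space M \<Longrightarrow> \<bar>f x\<bar> \<le> C" and "C \<ge> 0"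
  shows "\<bar>signed_integral M \<nu> f\<bar> \<le> 2 * K * C"
proof -
  have "\<bar>integral\<^sup>L (jordan_pos M \<nu>) f\<bar> \<le> K * C"
    by (rule abs_integral_jordan_pos_le) fact+
  moreover have "\<bar>integral\<^sup>L (jordan_neg M \<nu>) f\<bar> \<le> K * C"
    unfolding jordan_neg_def using assms
    by (intro abs_integral_jordan_pos_le) (simp_all add: signed_measure_uminus)
  ultimately show ?thesis unfolding signed_integral_def by linarith
qed

lemma signed_integral_linear:
  assumes \<nu>: "signed_measure M \<nu>" "total_variation M \<nu> \<le> ennreal K"
    and f: "f \<in> borel_measurable M" "\<And>x. x \<in> space M \<Longrightarrow> \<bar>f x\<bar> \<le> C"
    and g: "g \<in> borel_measurable M" "\<And>x. x \<in> space M \<Longrightarrow> \<bar>g x\<bar> \<le> D"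
  shows "signed_integral M \<nu> (\<lambda>x. a * f x + b * g x)
    = a * signed_integral M \<nu> f + b * signed_integral M \<nu> g"
proof -
  note \<nu>' = signed_measure_uminus[OF \<nu>(1)] \<nu>(2)[folded total_variation_uminus[of M \<nu>]]
  have "integrable (jordan_pos M \<nu>) f" by (rule integrable_jordan_pos[OF \<nu> f])
  moreover have "integrable (jordan_pos M \<nu>) g" by (rule integrable_jordan_pos[OF \<nu> g])
  moreover have "integrable (jordan_neg M \<nu>) f"
    unfolding jordan_neg_def by (rule integrable_jordan_pos[OF \<nu>' f])
  moreover have "integrable (jordan_neg M \<nu>) g"
    unfolding jordan_neg_def by (rule integrable_jordan_pos[OF \<nu>' g])
  ultimately show ?thesis unfolding signed_integral_def by (simp add: algebra_simps)
qed

section \<open>The right-hand side of the delay equation\<close>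

lemma continuous_on_Icc_imp_bounded:
  fixes f :: "real \<Rightarrow> real"
  assumes "continuous_on {a..b} f"
  obtains C where "\<And>x. x \<in> {a..b} \<Longrightarrow> \<bar>f x\<bar> \<le> C"
  using compact_imp_bounded[OF compact_continuous_image[OF assms compact_Icc]]
  unfolding bounded_iff real_norm_def by blast

text \<open>
  A path of coefficients on the half-line, detached from the flow that produces it. All estimates
  depend on the path through \<open>K\<close> alone.
\<close>
locale delay_equation =
  fixes \<nu> :: "real \<Rightarrow> real set \<Rightarrow> real" and K :: real
  assumes K_pos: "K > 0"
    and measurable_path: "\<And>T. T > 0 \<Longrightarrow> \<nu> \<in> measurable_paths K T"
begin

definition drift :: "(real \<Rightarrow> real) \<Rightarrow> real \<Rightarrow> real" where
  "drift z \<tau> = signed_integral history_borel (\<nu> \<tau>) (\<lambda>s. z (\<tau> + s))"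

lemma coefficient:
  assumes "\<tau> \<ge> 0"
  shows "signed_measure history_borel (\<nu> \<tau>)" "total_variation history_borel (\<nu> \<tau>) \<le> ennreal K"
  using measurable_path[of "\<tau> + 1"] assms
  by (auto simp: measurable_paths_def signed_measures_le_def)

lemma continuous_on_history:
  fixes z :: "real \<Rightarrow> real"
  assumes "continuous_on {-1..} z" "\<tau> \<ge> 0"
  shows "continuous_on {-1..0} (\<lambda>s. z (\<tau> + s))"
  by (rule continuous_on_compose2[OF assms(1)]) (use assms(2) in \<open>auto intro!: continuous_intros\<close>)

lemma abs_drift_le:
  assumes z: "continuous_on {-1..} z" and \<tau>: "\<tau> \<ge> 0"
    and bd: "\<And>s. s \<in> {-1..0} \<Longrightarrow> \<bar>z (\<tau> + s)\<bar> \<le> C"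
  shows "\<bar>drift z \<tau>\<bar> \<le> 2 * K * C"
proof -
  have "C \<ge> 0" using bd[of 0] by simp
  then show ?thesis
    unfolding drift_def
    using coefficient[OF \<tau>] K_pos bd continuous_on_history[OF z \<tau>]
    by (intro abs_signed_integral_le borel_measurable_continuous_on_restrict)
      (auto simp: space_restrict_space)
qed

lemma signed_integral_linear_continuous:
  fixes f g :: "real \<Rightarrow> real"
  assumes f: "continuous_on {-1..0} f" and g: "continuous_on {-1..0} g" and \<tau>: "\<tau> \<ge> 0"
  shows "signed_integral history_borel (\<nu> \<tau>) (\<lambda>s. a * f s + b * g s)
    = a * signed_integral history_borel (\<nu> \<tau>) f + b * signed_integral history_borel (\<nu> \<tau>) g"
proof -
  obtain C where "\<And>s. s \<in> {-1..0} \<Longrightarrow> \<bar>f s\<bar> \<le> C"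
    using continuous_on_Icc_imp_bounded[OF f] by blast
  moreover obtain D where "\<And>s. s \<in> {-1..0} \<Longrightarrow> \<bar>g s\<bar> \<le> D"
    using continuous_on_Icc_imp_bounded[OF g] by blast
  ultimately show ?thesis
    using f g by (intro signed_integral_linear[OF coefficient[OF \<tau>], where C=C and D=D]
        borel_measurable_continuous_on_restrict) (auto simp: space_restrict_space)
qed

lemma drift_linear:
  assumes "continuous_on {-1..} y" "continuous_on {-1..} z" "\<tau> \<ge> 0"
  shows "drift (\<lambda>t. a * y t + b * z t) \<tau> = a * drift y \<tau> + b * drift z \<tau>"
  unfolding drift_def
  using assms by (intro signed_integral_linear_continuous continuous_on_history)

text \<open>
  If the history is frozen at the grid point below \<open>\<tau>\<close>, the integrand takes countably many values as
  \<open>\<tau>\<close> varies, and for each of them measurability is the hypothesis on the path. By uniform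
  continuity of \<open>z\<close> on compact intervals and the bound on the functionals, the frozen integrals
  converge pointwise to the drift as the grid is refined.
\<close>
lemma borel_measurable_drift:
  assumes z: "continuous_on {-1..} z" and T: "T > 0"
  shows "drift z \<in> borel_measurable (lebesgue_on {0..T})"
proof (rule borel_measurable_LIMSEQ_real)
  \<comment> \<open>The clamp at \<open>0\<close> keeps the frozen history inside the domain \<open>[-1,\<infinity>)\<close> for negative indices,
    which no \<open>\<tau> \<ge> 0\<close> selects.\<close>
  define grid where "grid n k = max 0 (real_of_int k / real (Suc n))" for n and k :: int
  define node where "node n \<tau> = grid n \<lfloor>\<tau> * real (Suc n)\<rfloor>" for n and \<tau> :: real
  define F where "F n \<tau> = signed_integral history_borel (\<nu> \<tau>) (\<lambda>s. z (node n \<tau> + s))" for n \<tau>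
  have grid: "grid n k \<ge> 0" for n k by (simp add: grid_def)
  have node: "0 \<le> node n \<tau>" "node n \<tau> \<le> \<tau>" "\<tau> - node n \<tau> \<le> 1 / real (Suc n)" if "\<tau> \<ge> 0" for n \<tau>
  proof -
    define m where "m = real (Suc n)"
    have m: "m > 0" by (simp add: m_def)
    have k: "real_of_int \<lfloor>\<tau> * m\<rfloor> \<le> \<tau> * m" "\<tau> * m \<le> real_of_int \<lfloor>\<tau> * m\<rfloor> + 1" "0 \<le> \<lfloor>\<tau> * m\<rfloor>"
      using that m by (auto intro: less_imp_le real_of_int_floor_add_one_gt)
    have eq: "node n \<tau> = real_of_int \<lfloor>\<tau> * m\<rfloor> / m"
      using k m unfolding node_def grid_def m_def[symmetric] by simp
    have "\<tau> \<le> (real_of_int \<lfloor>\<tau> * m\<rfloor> + 1) / m"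
      using k m by (simp add: pos_le_divide_eq)
    then show "\<tau> - node n \<tau> \<le> 1 / real (Suc n)"
      unfolding eq m_def[symmetric] by (simp add: add_divide_distrib)
    show "0 \<le> node n \<tau>" "node n \<tau> \<le> \<tau>"
      unfolding eq using k m by (simp_all add: pos_divide_le_eq)
  qed
  show "F n \<in> borel_measurable (lebesgue_on {0..T})" for n
    unfolding F_def node_def
  proof (rule measurable_compose_countable)
    fix k :: int
    have "continuous_on {-1..0} (\<lambda>s. z (grid n k + s))"
      by (rule continuous_on_history[OF z grid])
    then show "(\<lambda>\<tau>. signed_integral history_borel (\<nu> \<tau>) (\<lambda>s. z (grid n k + s)))
        \<in> borel_measurable (lebesgue_on {0..T})"
      using measurable_path[OF T] by (simp add: measurable_paths_def)
  next
    have [measurable]: "(\<lambda>\<tau>::real. \<tau>) \<in> borel_measurable (lebesgue_on {0..T})"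
      by (intro measurable_restrict_space1 measurable_completion) simp
    show "(\<lambda>\<tau>. \<lfloor>\<tau> * real (Suc n)\<rfloor>) \<in> lebesgue_on {0..T} \<rightarrow>\<^sub>M count_space UNIV"
      by measurable
  qed
  fix \<tau> assume "\<tau> \<in> space (lebesgue_on {0..T})"
  then have \<tau>: "0 \<le> \<tau>" "\<tau> \<le> T" by (auto simp: space_restrict_space)
  have "uniformly_continuous_on {-1..T} z"
    by (intro compact_uniformly_continuous continuous_on_subset[OF z]) auto
  show "(\<lambda>n. F n \<tau>) \<longlonglongrightarrow> drift z \<tau>"
  proof (rule LIMSEQ_I)
    fix e :: real assume "e > 0"
    define e' where "e' = e / (4 * K)"
    have e': "e' > 0" "2 * K * e' < e" using \<open>e > 0\<close> K_pos by (auto simp: e'_def)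
    obtain d where "d > 0"
      and d: "\<And>x y. x \<in> {-1..T} \<Longrightarrow> y \<in> {-1..T} \<Longrightarrow> dist y x < d \<Longrightarrow> dist (z y) (z x) < e'"
      using \<open>uniformly_continuous_on {-1..T} z\<close> e' unfolding uniformly_continuous_on_def by metis
    obtain N where N: "1 / real (Suc N) < d"
      using \<open>d > 0\<close> nat_approx_posE by blast
    have "norm (F n \<tau> - drift z \<tau>) < e" if "n \<ge> N" for n
    proof -
      have "1 / real (Suc n) \<le> 1 / real (Suc N)" using that by (simp add: frac_le)
      with N node[OF \<tau>(1), of n] have close: "\<bar>node n \<tau> - \<tau>\<bar> < d" by simp
      have "F n \<tau> - drift z \<tau>
          = signed_integral history_borel (\<nu> \<tau>) (\<lambda>s. 1 * z (node n \<tau> + s) + (-1) * z (\<tau> + s))"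
        unfolding F_def drift_def
        using z \<tau> node(1)[OF \<tau>(1), of n]
        by (subst signed_integral_linear_continuous) (auto intro: continuous_on_history)
      also have "\<bar>\<dots>\<bar> \<le> 2 * K * e'"
      proof (rule abs_signed_integral_le[OF coefficient[OF \<tau>(1)]])
        have "continuous_on {-1..0} (\<lambda>s. 1 * z (node n \<tau> + s) + (-1) * z (\<tau> + s))"
          using z \<tau> node(1)[OF \<tau>(1), of n] by (intro continuous_intros continuous_on_history)
        then show "(\<lambda>s. 1 * z (node n \<tau> + s) + (-1) * z (\<tau> + s)) \<in> borel_measurable history_borel"
          by (rule borel_measurable_continuous_on_restrict)
        fix s assume "s \<in> space history_borel"
        then have "dist (z (node n \<tau> + s)) (z (\<tau> + s)) < e'"
          using node[OF \<tau>(1), of n] \<tau> close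
          by (intro d) (auto simp: space_restrict_space dist_real_def)
        then show "\<bar>1 * z (node n \<tau> + s) + (-1) * z (\<tau> + s)\<bar> \<le> e'"
          by (simp add: dist_real_def)
      qed (use K_pos e' in auto)
      finally show ?thesis using e' by simp
    qed
    then show "\<exists>N. \<forall>n\<ge>N. norm (F n \<tau> - drift z \<tau>) < e" by blast
  qed
qed

text \<open>
  Besides integrability, this passes from the Lebesgue integral in the definition of a solution to the
  Henstock-Kurzweil integral, for which the calculus of indefinite integrals is available.
\<close>
lemma drift_integrable:
  assumes z: "continuous_on {-1..} z" and t: "t \<ge> 0"
  shows "integrable (lebesgue_on {0..t}) (drift z)" "drift z integrable_on {0..t}"
    "(LINT \<tau>|lebesgue_on {0..t}. drift z \<tau>) = integral {0..t} (drift z)"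
proof -
  have "continuous_on {-1..t} z" by (rule continuous_on_subset[OF z]) auto
  then obtain C where C: "\<And>s. s \<in> {-1..t} \<Longrightarrow> \<bar>z s\<bar> \<le> C"
    using continuous_on_Icc_imp_bounded by blast
  have "drift z \<in> borel_measurable (lebesgue_on {0..t+1})"
    using t by (intro borel_measurable_drift[OF z]) simp
  then have meas: "drift z \<in> borel_measurable (lebesgue_on {0..t})"
    by (rule measurable_restrict_mono) auto
  have bound: "norm (drift z \<tau>) \<le> 2 * K * C" if "\<tau> \<in> {0..t}" for \<tau>
    unfolding real_norm_def using that by (intro abs_drift_le[OF z] C) auto
  show *: "integrable (lebesgue_on {0..t}) (drift z)"
    by (rule measurable_bounded_by_integrable_imp_lebesgue_integrable[OF meas Lebesgue_Measure.integrable_const_ivl bound]) auto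
  show "drift z integrable_on {0..t}" by (rule integrable_on_lebesgue_on[OF *]) simp
  show "(LINT \<tau>|lebesgue_on {0..t}. drift z \<tau>) = integral {0..t} (drift z)"
    by (rule lebesgue_integral_eq_integral[OF *]) simp
qed

lemma is_solution_iff:
  "is_solution \<nu> u0 z \<longleftrightarrow> continuous_on {-1..} z \<and> (\<forall>s\<in>{-1..0}. z s = u0 s) \<and>
     (\<forall>t\<ge>0. z t = u0 0 + integral {0..t} (drift z))"
proof -
  have eq: "(\<lambda>\<tau>. signed_integral history_borel (\<nu> \<tau>) (\<lambda>s. z (\<tau> + s))) = drift z"
    by (rule ext) (simp add: drift_def)
  show ?thesis
    unfolding is_solution_def eq using drift_integrable(1,3)[of z] by metis
qed

section \<open>Existence, uniqueness and growth of solutions\<close>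

text \<open>
  The history at time \<open>\<tau>\<close> only looks backwards, so the increasing weight at \<open>\<tau>\<close> dominates it, and integrating the
  exponential produces the factor \<open>1 / L\<close>. Capping the exponent from below at \<open>0\<close> gives the
  initial history the constant weight \<open>1\<close>.
\<close>
lemma abs_integral_drift_le:
  assumes z: "continuous_on {-1..} z" and t: "t \<ge> 0" and L: "L > 0"
    and bd: "\<And>s. s \<in> {-1..t} \<Longrightarrow> \<bar>z s\<bar> \<le> N * exp (L * max 0 s)"
  shows "\<bar>integral {0..t} (drift z)\<bar> \<le> 2 * K * N / L * exp (L * t)"
proof -
  have N: "N \<ge> 0" using bd[of 0] t by simp
  have "((\<lambda>\<tau>. 2 * K * N * exp (L * \<tau>)) has_integral
      2 * K * N / L * exp (L * t) - 2 * K * N / L * exp (L * 0)) {0..t}"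
    by (rule fundamental_theorem_of_calculus[OF t])
      (use L in \<open>auto intro!: derivative_eq_intros simp: has_real_derivative_iff_has_vector_derivative[symmetric]\<close>)
  then have hi: "((\<lambda>\<tau>. 2 * K * N * exp (L * \<tau>)) has_integral
      2 * K * N / L * exp (L * t) - 2 * K * N / L) {0..t}" by simp
  note int = has_integral_integrable[OF hi] and eq = integral_unique[OF hi]
  have "\<bar>integral {0..t} (drift z)\<bar> \<le> integral {0..t} (\<lambda>\<tau>. 2 * K * N * exp (L * \<tau>))"
    unfolding real_norm_def[symmetric]
  proof (rule Henstock_Kurzweil_Integration.integral_norm_bound_integral[OF drift_integrable(2)[OF z t] int])
    fix \<tau> assume \<tau>: "\<tau> \<in> {0..t}"
    have "\<bar>z (\<tau> + s)\<bar> \<le> N * exp (L * \<tau>)" if s: "s \<in> {-1..0}" for s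
    proof -
      have "\<bar>z (\<tau> + s)\<bar> \<le> N * exp (L * max 0 (\<tau> + s))" using \<tau> s by (intro bd) auto
      also have "\<dots> \<le> N * exp (L * \<tau>)" using \<tau> s N L by (intro mult_left_mono) auto
      finally show ?thesis .
    qed
    then show "norm (drift z \<tau>) \<le> 2 * K * N * exp (L * \<tau>)"
      using abs_drift_le[OF z, of \<tau> "N * exp (L * \<tau>)"] \<tau> by (simp add: mult.assoc)
  qed
  also have "\<dots> \<le> 2 * K * N / L * exp (L * t)"
    unfolding eq using K_pos N L by simp
  finally show ?thesis .
qed

text \<open>
  A Gronwall-type bound: let \<open>p\<close> maximise the weighted size \<open>w\<close> on \<open>[-1,t]\<close>. If
  \<open>p > 0\<close>, the integral equation gives \<open>w p \<le> R + w p / 2\<close>, where the \<open>1/2\<close> is \<open>2 * K / L\<close> for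
  \<open>L = 4 * K\<close>; hence \<open>w p \<le> 2 * R\<close>.
\<close>
lemma solution_growth:
  assumes sol: "is_solution \<nu> u z" and u: "\<And>s. s \<in> {-1..0} \<Longrightarrow> \<bar>u s\<bar> \<le> R" and t: "t \<ge> -1"
  shows "\<bar>z t\<bar> \<le> 2 * R * exp (4 * K * max 0 t)"
proof -
  have z: "continuous_on {-1..} z" and init: "\<And>s. s \<in> {-1..0} \<Longrightarrow> z s = u s"
    and eq: "\<And>t. t \<ge> 0 \<Longrightarrow> z t = u 0 + integral {0..t} (drift z)"
    using sol by (auto simp: is_solution_iff)
  have R: "R \<ge> 0" using u[of 0] by simp
  define w where "w s = \<bar>z s\<bar> * exp (- (4 * K * max 0 s))" for s
  have zw: "\<bar>z s\<bar> = w s * exp (4 * K * max 0 s)" for s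
    by (simp add: w_def mult.assoc exp_add[symmetric])
  have "continuous_on {-1..t} w"
    unfolding w_def by (intro continuous_intros continuous_on_subset[OF z]) auto
  then obtain p where p: "p \<in> {-1..t}" and max: "\<And>s. s \<in> {-1..t} \<Longrightarrow> w s \<le> w p"
    using continuous_attains_sup[of "{-1..t}" w] t by auto
  have "w p \<le> 2 * R"
  proof (cases "p \<le> 0")
    case True
    then have "w p = \<bar>u p\<bar>" using p init[of p] by (simp add: w_def)
    then show ?thesis using True p u[of p] R by simp
  next
    case False
    have "\<bar>integral {0..p} (drift z)\<bar> \<le> 2 * K * w p / (4 * K) * exp (4 * K * p)"
      using False K_pos p zw by (intro abs_integral_drift_le[OF z]) (auto intro!: max)
    also have "\<dots> = w p / 2 * exp (4 * K * p)" using K_pos by simp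
    finally have "\<bar>z p\<bar> \<le> R + w p / 2 * exp (4 * K * p)"
      using eq[of p] u[of 0] False by simp
    also have "R \<le> R * exp (4 * K * p)"
      using R K_pos False by (simp add: mult_le_cancel_left1)
    finally have "w p * exp (4 * K * p) \<le> (R + w p / 2) * exp (4 * K * p)"
      using zw[of p] False by (simp add: algebra_simps max_def)
    then show ?thesis by simp
  qed
  then have "w t \<le> 2 * R" using max[of t] t by simp
  then show ?thesis unfolding zw by simp
qed

lemma is_solution_linear:
  assumes y: "is_solution \<nu> u y" and z: "is_solution \<nu> v z"
  shows "is_solution \<nu> (\<lambda>s. a * u s + b * v s) (\<lambda>t. a * y t + b * z t)"
proof -
  have y': "continuous_on {-1..} y" and z': "continuous_on {-1..} z"
    using y z by (auto simp: is_solution_iff)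
  have "integral {0..t} (drift (\<lambda>t. a * y t + b * z t))
      = a * integral {0..t} (drift y) + b * integral {0..t} (drift z)" if "t \<ge> 0" for t
  proof -
    have "integral {0..t} (drift (\<lambda>t. a * y t + b * z t)) = integral {0..t} (\<lambda>\<tau>. a * drift y \<tau> + b * drift z \<tau>)"
      using y' z' by (intro Henstock_Kurzweil_Integration.integral_cong drift_linear) auto
    also have "\<dots> = a * integral {0..t} (drift y) + b * integral {0..t} (drift z)"
      using drift_integrable(2)[OF y' that] drift_integrable(2)[OF z' that]
      by (simp add: Henstock_Kurzweil_Integration.integral_add integrable_on_mult_right)
    finally show ?thesis .
  qed
  then show ?thesis
    using y z unfolding is_solution_iff by (auto intro!: continuous_intros simp: algebra_simps)
qed

text \<open>
  The difference of two solutions is a solution with initial history \<open>0\<close>, to which the growth bound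
  applies with \<open>R = 0\<close>.
\<close>
lemma is_solution_unique:
  assumes y: "is_solution \<nu> u y" and z: "is_solution \<nu> u z" and t: "t \<ge> -1"
  shows "y t = z t"
proof -
  have "\<bar>1 * y t + (-1) * z t\<bar> \<le> 2 * 0 * exp (4 * K * max 0 t)"
    by (rule solution_growth[OF is_solution_linear[OF y z, of 1 "-1"] _ t]) simp
  then show ?thesis by simp
qed

text \<open>
  Banach's fixed point theorem in the weighted space: the unknown is \<open>w t = exp (- L * t) * (z t - u 0)\<close>,
  a bounded continuous function. The fixed point equation is posed for all bounded continuous
  functions on the line, a complete space, and not on the subset with \<open>w 0 = 0\<close>; therefore \<open>Z\<close>, which
  turns \<open>w\<close> back into a candidate for the solution, subtracts \<open>w 0\<close> in order to agree with \<open>u\<close> on \<open>[-1,0]\<close>.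
  A fixed point vanishes at \<open>0\<close> automatically.
\<close>
lemma is_solution_exists:
  assumes u: "continuous_on {-1..0} u"
  shows "\<exists>z. is_solution \<nu> u z"
proof -
  obtain R where R: "\<And>s. s \<in> {-1..0} \<Longrightarrow> \<bar>u s\<bar> \<le> R"
    using continuous_on_Icc_imp_bounded[OF u] by blast
  have R0: "R \<ge> 0" using R[of 0] by simp
  \<comment> \<open>Subtracting \<open>w 0\<close> costs a factor \<open>2\<close>, so that the contraction constant is
    \<open>2 * (2 * K) / L = 1/2\<close>.\<close>
  define L where "L = 8 * K"
  have L: "L > 0" using K_pos by (simp add: L_def)
  define Z :: "(real \<Rightarrow>\<^sub>C real) \<Rightarrow> real \<Rightarrow> real" where
    "Z w t = u (max (-1) (min 0 t)) + exp (L * max 0 t) * (w (max 0 t) - w 0)" for w t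
  define G :: "(real \<Rightarrow>\<^sub>C real) \<Rightarrow> real \<Rightarrow> real" where
    "G w t = exp (- (L * max 0 t)) * integral {0..max 0 t} (drift (Z w))" for w t
  have weight: "\<bar>exp (- a) * x\<bar> \<le> c" if "\<bar>x\<bar> \<le> c * exp a" for a x c :: real
    using that by (simp add: exp_minus abs_mult inverse_eq_divide pos_divide_le_eq)
  have contZ: "continuous_on S (Z w)" for w S
    unfolding Z_def
    by (intro continuous_intros continuous_on_compose2[OF u] continuous_on_compose2[OF continuous_on_apply_bcontfun[of UNIV]]) auto
  have diffZ: "\<bar>Z w s - Z w' s\<bar> \<le> 2 * dist w w' * exp (L * max 0 s)" for w w' s
  proof -
    have "\<bar>(w (max 0 s) - w 0) - (w' (max 0 s) - w' 0)\<bar> \<le> 2 * dist w w'"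
      using dist_bounded[of w "max 0 s" w'] dist_bounded[of w 0 w'] by (auto simp: dist_real_def)
    then have "exp (L * max 0 s) * \<bar>(w (max 0 s) - w 0) - (w' (max 0 s) - w' 0)\<bar> \<le> exp (L * max 0 s) * (2 * dist w w')"
      by (intro mult_left_mono) auto
    moreover have "\<bar>Z w s - Z w' s\<bar> = exp (L * max 0 s) * \<bar>(w (max 0 s) - w 0) - (w' (max 0 s) - w' 0)\<bar>"
      by (simp add: Z_def abs_mult flip: right_diff_distrib)
    ultimately show ?thesis by (simp add: mult.commute)
  qed
  have boundZ: "\<bar>Z w s\<bar> \<le> (R + 2 * dist w 0) * exp (L * max 0 s)" for w s
  proof -
    have "\<bar>Z 0 s\<bar> \<le> R * 1" using R[of "max (-1) (min 0 s)"] by (simp add: Z_def)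
    also have "\<dots> \<le> R * exp (L * max 0 s)" using R0 L by (intro mult_left_mono) auto
    finally show ?thesis using diffZ[of w s 0] by (simp add: algebra_simps)
  qed
  have Gbcont: "G w \<in> bcontfun" for w
  proof (rule bcontfun_normI)
    have "continuous_on {0..} (\<lambda>t. integral {0..t} (drift (Z w)))"
      unfolding continuous_on_eq_continuous_within
    proof
      fix t :: real assume t: "t \<in> {0..}"
      have "continuous_on {0..t+1} (\<lambda>t. integral {0..t} (drift (Z w)))"
        using t by (intro indefinite_integral_continuous_1 drift_integrable(2) contZ) auto
      then have "continuous (at t within {0..t+1}) (\<lambda>t. integral {0..t} (drift (Z w)))"
        using t by (auto simp: continuous_on_eq_continuous_within)
      moreover have "at t within {0..t+1} = at t within {0..}"
        by (rule at_within_nhd[where S="{..<t+1}"]) auto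
      ultimately show "continuous (at t within {0..}) (\<lambda>t. integral {0..t} (drift (Z w)))"
        by simp
    qed
    then show "continuous_on UNIV (G w)"
      unfolding G_def by (intro continuous_intros continuous_on_compose2[of "{0..}" _ UNIV "max 0"]) auto
    fix t
    have "\<bar>integral {0..max 0 t} (drift (Z w))\<bar> \<le> 2 * K * (R + 2 * dist w 0) / L * exp (L * max 0 t)"
      using L boundZ by (intro abs_integral_drift_le contZ) auto
    then show "norm (G w t) \<le> 2 * K * (R + 2 * dist w 0) / L"
      unfolding G_def real_norm_def by (rule weight)
  qed
  have "\<exists>!w. Bcontfun (G w) = w"
  proof (rule banach_fix_type[where c="1/2"])
    show "\<forall>w w'. dist (Bcontfun (G w)) (Bcontfun (G w')) \<le> 1/2 * dist w w'"
    proof (intro allI dist_bound)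
      fix w w' :: "real \<Rightarrow>\<^sub>C real" and t :: real
      define T where "T = max 0 t"
      have T: "T \<ge> 0" by (simp add: T_def)
      have drift: "drift (\<lambda>t. 1 * Z w t + (-1) * Z w' t) \<tau> = 1 * drift (Z w) \<tau> + (-1) * drift (Z w') \<tau>"
        if "\<tau> \<ge> 0" for \<tau>
        using that by (intro drift_linear contZ)
      have "integral {0..T} (drift (Z w)) - integral {0..T} (drift (Z w'))
          = integral {0..T} (\<lambda>\<tau>. drift (Z w) \<tau> - drift (Z w') \<tau>)"
        using T by (intro Henstock_Kurzweil_Integration.integral_diff[symmetric] drift_integrable(2) contZ)
      also have "\<dots> = integral {0..T} (drift (\<lambda>t. 1 * Z w t + (-1) * Z w' t))"
        using drift by (intro Henstock_Kurzweil_Integration.integral_cong) simp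
      also have "\<bar>\<dots>\<bar> \<le> 2 * K * (2 * dist w w') / L * exp (L * T)"
        using T L diffZ[of w _ w'] by (intro abs_integral_drift_le continuous_intros contZ) auto
      also have "\<dots> = 1/2 * dist w w' * exp (L * T)" using K_pos by (simp add: L_def)
      finally have "\<bar>exp (- (L * T)) * (integral {0..T} (drift (Z w)) - integral {0..T} (drift (Z w')))\<bar>
          \<le> 1/2 * dist w w'"
        by (rule weight)
      then show "dist (Bcontfun (G w) t) (Bcontfun (G w') t) \<le> 1/2 * dist w w'"
        by (simp add: Bcontfun_inverse[OF Gbcont] dist_real_def G_def T_def[symmetric] right_diff_distrib)
    qed
  qed auto
  then obtain w where "Bcontfun (G w) = w" by blast
  then have fixpoint: "w t = G w t" for t using Bcontfun_inverse[OF Gbcont, of w] by simp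
  have w0: "w 0 = 0" by (simp add: fixpoint G_def)
  have "is_solution \<nu> u (Z w)"
    unfolding is_solution_iff
  proof (intro conjI ballI allI impI contZ)
    show "Z w s = u s" if "s \<in> {-1..0}" for s
      using that by (auto simp: Z_def max_def min_def)
    show "Z w t = u 0 + integral {0..t} (drift (Z w))" if "t \<ge> 0" for t
    proof -
      have "exp (L * t) * w t = integral {0..t} (drift (Z w))"
        using that by (simp add: fixpoint G_def mult.assoc[symmetric] exp_add[symmetric])
      then show ?thesis using that w0 by (simp add: Z_def)
    qed
  qed
  then show ?thesis by blast
qed

lemma is_solution_cong:
  assumes "\<And>s. s \<in> {-1..0} \<Longrightarrow> u s = v s" and eq: "\<And>t. t \<ge> -1 \<Longrightarrow> y t = z t"
    and y: "is_solution \<nu> u y"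
  shows "is_solution \<nu> v z"
proof -
  have "drift z \<tau> = drift y \<tau>" if "\<tau> \<ge> 0" for \<tau>
    unfolding drift_def using that
    by (intro signed_integral_cong) (auto simp: space_restrict_space eq)
  then have "integral {0..t} (drift z) = integral {0..t} (drift y)" for t
    by (intro Henstock_Kurzweil_Integration.integral_cong) simp
  moreover have "continuous_on {-1..} z \<longleftrightarrow> continuous_on {-1..} y"
    by (intro continuous_on_cong) (simp_all add: eq)
  ultimately show ?thesis
    using assms unfolding is_solution_iff by auto
qed

text \<open>
  A solution is determined only on \<open>[-1,\<infinity>)\<close>; its extensional restriction is the unique function that
  the definite description asks for.
\<close>
lemma is_solution_solution:
  assumes "continuous_on {-1..0} u"
  shows "is_solution \<nu> u (solution \<nu> u)"
proof -
  obtain z where z: "is_solution \<nu> u z" using is_solution_exists[OF assms] by blast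
  have "\<exists>!z. z \<in> extensional {-1..} \<and> is_solution \<nu> u z"
  proof (rule ex1I)
    show "restrict z {-1..} \<in> extensional {-1..} \<and> is_solution \<nu> u (restrict z {-1..})"
      using z by (auto intro: is_solution_cong[of u u z])
    fix y assume y: "y \<in> extensional {-1..} \<and> is_solution \<nu> u y"
    show "y = restrict z {-1..}"
      by (rule extensionalityI[of _ "{-1..}"]) (use y is_solution_unique[of u y z] z in auto)
  qed
  from theI'[OF this] show ?thesis by (simp add: solution_def)
qed

text \<open>
  This is the smoothing: after time \<open>0\<close> the Lipschitz constant depends on the initial history only
  through its size, not through its modulus of continuity.
\<close>
lemma solution_lipschitz:
  assumes sol: "is_solution \<nu> u z" and u: "\<And>s. s \<in> {-1..0} \<Longrightarrow> \<bar>u s\<bar> \<le> R"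
    and t: "0 \<le> a" "a \<le> b" "b \<le> T"
  shows "\<bar>z b - z a\<bar> \<le> 4 * K * R * exp (4 * K * T) * (b - a)"
proof -
  have z: "continuous_on {-1..} z" using sol by (simp add: is_solution_iff)
  have R: "R \<ge> 0" using u[of 0] by simp
  have int: "drift z integrable_on {0..b}" using t by (intro drift_integrable(2)[OF z]) simp
  then have int': "drift z integrable_on {a..b}"
    by (rule integrable_subinterval_real) (use t in auto)
  have "z b - z a = integral {0..b} (drift z) - integral {0..a} (drift z)"
    using sol t unfolding is_solution_iff by auto
  also have "\<dots> = integral {a..b} (drift z)"
    using Henstock_Kurzweil_Integration.integral_combine[OF t(1,2) int] by simp
  also have "norm \<dots> \<le> integral {a..b} (\<lambda>_. 4 * K * R * exp (4 * K * T))"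
  proof (rule Henstock_Kurzweil_Integration.integral_norm_bound_integral[OF int'])
    show "(\<lambda>_. 4 * K * R * exp (4 * K * T)) integrable_on {a..b}"
      by (rule Henstock_Kurzweil_Integration.integrable_const_ivl)
    fix \<tau> assume \<tau>: "\<tau> \<in> {a..b}"
    have "\<bar>z (\<tau> + s)\<bar> \<le> 2 * R * exp (4 * K * T)" if "s \<in> {-1..0}" for s
    proof -
      have "\<bar>z (\<tau> + s)\<bar> \<le> 2 * R * exp (4 * K * max 0 (\<tau> + s))"
        using \<tau> that t by (intro solution_growth[OF sol u]) auto
      also have "\<dots> \<le> 2 * R * exp (4 * K * T)"
        using \<tau> that t R K_pos by (intro mult_left_mono) auto
      finally show ?thesis .
    qed
    then have "\<bar>drift z \<tau>\<bar> \<le> 2 * K * (2 * R * exp (4 * K * T))"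
      using \<tau> t by (intro abs_drift_le[OF z]) auto
    then show "norm (drift z \<tau>) \<le> 4 * K * R * exp (4 * K * T)" by simp
  qed
  finally show ?thesis using t by (simp add: algebra_simps)
qed

end

section \<open>Compact sets of histories\<close>

lemma mspace_C_hist: "mspace C_hist = {f \<in> extensional {-1..0}. continuous_on {-1..0} f}"
  unfolding C_hist_def by (subst compactin_mspace_cfunspace) auto

lemma restrict_in_C_hist:
  assumes "continuous_on {-1..0} f"
  shows "(\<lambda>s\<in>{-1..0}. f s) \<in> mspace C_hist"
  unfolding mspace_C_hist using continuous_on_eq[OF assms, of "restrict f {-1..0}"] by simp

lemma mdist_C_hist_le:
  assumes "f \<in> mspace C_hist" "g \<in> mspace C_hist"
  shows "mdist C_hist f g \<le> a \<longleftrightarrow> (\<forall>s\<in>{-1..0}. \<bar>f s - g s\<bar> \<le> a)"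
  using assms unfolding C_hist_def by (subst cfunspace_mdist_le) (auto simp: dist_real_def)

lemma mcomplete_C_hist: "Metric_space.mcomplete (mspace C_hist) (mdist C_hist)"
proof -
  have "(Met_TC.Self :: real metric) = euclidean_metric"
    by (simp add: Met_TC.Self_def euclidean_metric_def)
  then show ?thesis
    using Met_TC.mcomplete_cfunspace[where 'a=real] complete_UNIV
    unfolding C_hist_def mcomplete_of_def mcomplete_iff_complete by metis
qed

text \<open>
  By completeness, relative compactness is total boundedness, that is, every sequence has a Cauchy
  subsequence; the theorem of Arzela and Ascoli extracts a uniformly convergent one.
\<close>
lemma compactin_closure_C_hist:
  assumes S: "S \<subseteq> mspace C_hist"
    and bd: "\<And>f s. f \<in> S \<Longrightarrow> s \<in> {-1..0} \<Longrightarrow> \<bar>f s\<bar> \<le> M"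
    and lip: "\<And>f s s'. f \<in> S \<Longrightarrow> s \<in> {-1..0} \<Longrightarrow> s' \<in> {-1..0} \<Longrightarrow> \<bar>f s - f s'\<bar> \<le> C * \<bar>s - s'\<bar>"
  shows "compactin (mtopology_of C_hist) (mtopology_of C_hist closure_of S)"
proof -
  interpret Metric_space "mspace C_hist" "mdist C_hist" by simp
  have "mtotally_bounded S"
    unfolding mtotally_bounded_sequentially
  proof (intro conjI S allI impI)
    fix \<sigma> :: "nat \<Rightarrow> real \<Rightarrow> real" assume "range \<sigma> \<subseteq> S"
    then have \<sigma>: "\<sigma> n \<in> S" for n by auto
    have equi: "\<exists>d>0. \<forall>n y. y \<in> {-1..0} \<and> norm (x - y) < d \<longrightarrow> norm (\<sigma> n x - \<sigma> n y) < e"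
      if x: "x \<in> {-1..0}" and e: "0 < e" for x e :: real
    proof (intro exI conjI allI impI)
      show "e / (\<bar>C\<bar> + 1) > 0" using e by simp
      fix n y assume y: "y \<in> {-1..0} \<and> norm (x - y) < e / (\<bar>C\<bar> + 1)"
      have "norm (\<sigma> n x - \<sigma> n y) \<le> C * \<bar>x - y\<bar>" using lip[OF \<sigma> x, of y] y by simp
      also have "\<dots> \<le> (\<bar>C\<bar> + 1) * \<bar>x - y\<bar>" by (intro mult_right_mono) auto
      also have "\<dots> < e" using y by (simp add: pos_less_divide_eq mult.commute)
      finally show "norm (\<sigma> n x - \<sigma> n y) < e" .
    qed
    obtain g k where k: "strict_mono (k :: nat \<Rightarrow> nat)"
      and g: "\<And>e. 0 < e \<Longrightarrow> \<exists>N. \<forall>n x. n \<ge> N \<and> x \<in> {-1..0} \<longrightarrow> norm (\<sigma> (k n) x - g x) < e"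
      using Arzela_Ascoli[of "{-1..0::real}" \<sigma> M, OF compact_Icc] bd[OF \<sigma>] equi
      by (metis real_norm_def)
    have "MCauchy (\<sigma> \<circ> k)"
      unfolding MCauchy_def
    proof (intro conjI allI impI)
      show "range (\<sigma> \<circ> k) \<subseteq> mspace C_hist" using \<sigma> S by auto
      fix e :: real assume "e > 0"
      then obtain N where N: "\<And>n x. n \<ge> N \<Longrightarrow> x \<in> {-1..0} \<Longrightarrow> norm (\<sigma> (k n) x - g x) < e / 4"
        using g[of "e / 4"] by auto
      have "mdist C_hist ((\<sigma> \<circ> k) n) ((\<sigma> \<circ> k) m) < e" if "N \<le> n" "N \<le> m" for n m
      proof -
        have "\<bar>\<sigma> (k n) x - \<sigma> (k m) x\<bar> \<le> e / 2" if "x \<in> {-1..0}" for x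
          using N[OF \<open>N \<le> n\<close> that] N[OF \<open>N \<le> m\<close> that] unfolding real_norm_def by linarith
        then have "mdist C_hist ((\<sigma> \<circ> k) n) ((\<sigma> \<circ> k) m) \<le> e / 2"
          using \<sigma> S by (subst mdist_C_hist_le) auto
        then show ?thesis using \<open>e > 0\<close> by simp
      qed
      then show "\<exists>N. \<forall>n n'. N \<le> n \<longrightarrow> N \<le> n' \<longrightarrow> mdist C_hist ((\<sigma> \<circ> k) n) ((\<sigma> \<circ> k) n') < e"
        by blast
    qed
    with k show "\<exists>r. strict_mono r \<and> MCauchy (\<sigma> \<circ> r)" by blast
  qed
  then show ?thesis
    using mtotally_bounded_eq_compact_closure_of[OF mcomplete_C_hist] by (simp add: mtopology_of_def)
qed

text \<open>
  Boundedness in a metric space refers to an arbitrary centre; adjoining the zero function to \<open>B\<close>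
  turns it into a uniform bound on values.
\<close>
lemma mbounded_C_hist:
  assumes "Metric_space.mbounded (mspace C_hist) (mdist C_hist) B"
  obtains R where "B \<subseteq> mspace C_hist" "\<And>u s. u \<in> B \<Longrightarrow> s \<in> {-1..0} \<Longrightarrow> \<bar>u s\<bar> \<le> R"
proof -
  interpret Metric_space "mspace C_hist" "mdist C_hist" by simp
  define c where "c = (\<lambda>s\<in>{-1..0::real}. 0::real)"
  have c: "c \<in> mspace C_hist"
    unfolding c_def by (intro restrict_in_C_hist continuous_on_const)
  have B: "B \<subseteq> mspace C_hist" using assms mbounded_subset_mspace by blast
  have "mbounded (insert c B)" using assms c by (simp add: mbounded_insert)
  then obtain R where R: "\<And>u. u \<in> B \<Longrightarrow> mdist C_hist u c \<le> R"
    unfolding mbounded_alt by blast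
  show thesis
  proof (rule that[OF B])
    show "\<bar>u s\<bar> \<le> R" if "u \<in> B" "s \<in> {-1..0}" for u s
      using mdist_C_hist_le[of u c R] R[of u] that c B by (auto simp: c_def)
  qed
qed

section \<open>Compactness of the solution operator\<close>

text \<open>
  Linearity comes from uniqueness, since the linear combination of two solutions solves the equation
  with the combined history. Compactness comes from the growth and Lipschitz bounds on \<open>[0,1]\<close>.
\<close>
lemma (in delay_equation) compact_solution_operator: "compact_operator_C (solution_operator \<nu> 1)"
  unfolding compact_operator_C_def
proof (intro conjI allI ballI impI)
  have U: "solution_operator \<nu> 1 u s = solution \<nu> u (1 + s)" if "s \<in> {-1..0}" for u s
    using that by (simp add: solution_operator_def)
  have maps: "solution_operator \<nu> 1 u \<in> mspace C_hist" if "u \<in> mspace C_hist" for u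
  proof -
    have "continuous_on {-1..} (solution \<nu> u)"
      using is_solution_solution[of u] that by (simp add: mspace_C_hist is_solution_iff)
    then have "continuous_on {-1..0} (\<lambda>s. solution \<nu> u (1 + s))"
      by (rule continuous_on_history) simp
    then show ?thesis
      unfolding solution_operator_def by (rule restrict_in_C_hist)
  qed
  then show "solution_operator \<nu> 1 \<in> mspace C_hist \<rightarrow> mspace C_hist" by blast
  show "solution_operator \<nu> 1 (\<lambda>s\<in>{-1..0}. a * u s + b * v s)
      = (\<lambda>s\<in>{-1..0}. a * solution_operator \<nu> 1 u s + b * solution_operator \<nu> 1 v s)"
    if u: "u \<in> mspace C_hist" and v: "v \<in> mspace C_hist" for a b u v
  proof -
    let ?w = "\<lambda>s\<in>{-1..0}. a * u s + b * v s"
    have "is_solution \<nu> ?w (\<lambda>t. a * solution \<nu> u t + b * solution \<nu> v t)"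
      using is_solution_linear[OF is_solution_solution is_solution_solution, of u v a b] u v
      by (auto simp: mspace_C_hist intro: is_solution_cong[rotated 2])
    moreover have "continuous_on {-1..0} (\<lambda>s. a * u s + b * v s)"
      using u v by (intro continuous_intros) (auto simp: mspace_C_hist)
    then have "is_solution \<nu> ?w (solution \<nu> ?w)"
      by (intro is_solution_solution) (use restrict_in_C_hist in \<open>auto simp: mspace_C_hist\<close>)
    ultimately have "solution \<nu> ?w t = a * solution \<nu> u t + b * solution \<nu> v t" if "t \<ge> -1" for t
      using is_solution_unique that by blast
    then show ?thesis by (auto simp: solution_operator_def restrict_def)
  qed
  fix B assume "Metric_space.mbounded (mspace C_hist) (mdist C_hist) B"
  then obtain R where B: "B \<subseteq> mspace C_hist"
    and R: "\<And>u s. u \<in> B \<Longrightarrow> s \<in> {-1..0} \<Longrightarrow> \<bar>u s\<bar> \<le> R"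
    using mbounded_C_hist by blast
  have sol: "is_solution \<nu> u (solution \<nu> u)" if "u \<in> B" for u
    using that B by (intro is_solution_solution) (auto simp: mspace_C_hist)
  show "compactin (mtopology_of C_hist) (mtopology_of C_hist closure_of (solution_operator \<nu> 1 ` B))"
  proof (rule compactin_closure_C_hist)
    show "solution_operator \<nu> 1 ` B \<subseteq> mspace C_hist" using maps B by blast
    fix f s assume f: "f \<in> solution_operator \<nu> 1 ` B" and s: "s \<in> {-1..0::real}"
    then obtain u where u: "u \<in> B" and f_eq: "f = solution_operator \<nu> 1 u" by blast
    have "R \<ge> 0" using R[OF u, of 0] by simp
    have "\<bar>solution \<nu> u (1 + s)\<bar> \<le> 2 * R * exp (4 * K * max 0 (1 + s))"
      using s by (intro solution_growth[OF sol[OF u] R[OF u]]) auto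
    also have "\<dots> \<le> 2 * R * exp (4 * K)"
      using s \<open>R \<ge> 0\<close> K_pos by (intro mult_left_mono) auto
    finally show "\<bar>f s\<bar> \<le> 2 * R * exp (4 * K)" using s by (simp add: f_eq U)
    fix s' assume s': "s' \<in> {-1..0::real}"
    have "\<bar>solution \<nu> u (1 + b) - solution \<nu> u (1 + a)\<bar> \<le> 4 * K * R * exp (4 * K) * \<bar>b - a\<bar>"
      if "a \<in> {-1..0}" "b \<in> {-1..0}" "a \<le> b" for a b
      using solution_lipschitz[OF sol[OF u] R[OF u], of "1 + a" "1 + b" 1] that by simp
    from this[of s s'] this[of s' s] show "\<bar>f s - f s'\<bar> \<le> 4 * K * R * exp (4 * K) * \<bar>s - s'\<bar>"
      using s s' by (cases "s \<le> s'") (simp_all add: f_eq U abs_minus_commute)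
  qed
qed

theorem theorem8p1:
  fixes \<Omega> :: "'w set"
    and \<theta> :: "real \<Rightarrow> 'w \<Rightarrow> 'w"
    and K :: real
    and \<mu> :: "'w \<Rightarrow> real set \<Rightarrow> real"
  assumes "flow_on \<Omega> \<theta>"
    and "K > 0"
    and "\<And>\<omega>. \<omega> \<in> \<Omega> \<Longrightarrow> \<mu> \<omega> \<in> signed_measures_le K"
    and "\<And>\<omega> T. \<omega> \<in> \<Omega> \<Longrightarrow> T > 0 \<Longrightarrow> (\<lambda>t. \<mu> (\<theta> t \<omega>)) \<in> measurable_paths K T"
  shows "\<forall>\<omega>\<in>\<Omega>. compact_operator_C (solution_operator (\<lambda>t. \<mu> (\<theta> t \<omega>)) 1)"
proof
  fix \<omega> assume "\<omega> \<in> \<Omega>"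
  then interpret delay_equation "\<lambda>t. \<mu> (\<theta> t \<omega>)" K
    using assms by unfold_locales auto
  show "compact_operator_C (solution_operator (\<lambda>t. \<mu> (\<theta> t \<omega>)) 1)"
    by (rule compact_solution_operator)
qed

end
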